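(* Let $(M,\varphi,\xi,\eta,g)$ be a $\beta$-Kenmotsu manifold which is special weakly Ricci symmetric. Then $(M,g)$ is an Einstein space, i.e. its Ricci tensor satisfies $S=c\,g$ for some real constant $c$.
   Context: All objects are $C^\infty$; manifolds are connected. An almost contact metric manifold is a $(2n+1)$-dimensional manifold $M$ ($n\ge 1$) with a $(1,1)$-tensor field $\varphi$, a vector field $\xi$, a 1-form $\eta$ and a Riemannian metric $g$ such that $\varphi^2=-I+\eta\otimes\xi$, $\eta(\xi)=1$, $\eta\circ\varphi=0$, $\varphi(\xi)=0$, $\eta(X)=g(X,\xi)$ and $g(\varphi X,\varphi Y)=g(X,Y)-\eta(X)\eta(Y)$ for all vector fields $X,Y$. For a constant $\beta>0$, it is a $\beta$-Kenmotsu manifold if its Levi-Civita connection $\nabla$ satisfies $(\nabla_X\varphi)(Y)=\beta\,(g(\varphi X,Y)\xi-\varphi(X)\eta(Y))$ for all $X,Y$. A Riemannian manifold with Ricci tensor $S$ is special weakly Ricci symmetric if there exists a 1-form $\rho$ such that $(\nabla_XS)(Y,Z)=2\rho(X)S(Y,Z)+\rho(Y)S(Z,X)+\rho(Z)S(X,Y)$ for all vector fields $X,Y,Z$. *)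

theory Defs
  imports "HOL-Analysis.Analysis" "HOL-Library.Function_Algebras"
begin

text \<open>The predicate below is meant for open \<open>S\<close>; there it says that all iterated partial
  derivatives of order up to \<open>k\<close> exist and are continuous.\<close>

primrec Ck_on :: "nat \<Rightarrow> 'e::euclidean_space set \<Rightarrow> ('e \<Rightarrow> 'f::real_normed_vector) \<Rightarrow> bool" where
  "Ck_on 0 S f \<longleftrightarrow> continuous_on S f"
| "Ck_on (Suc k) S f \<longleftrightarrow> (\<forall>x\<in>S. f differentiable (at x)) \<and>
     (\<forall>i\<in>Basis. Ck_on k S (\<lambda>x. frechet_derivative f (at x) i))"

definition smooth_on :: "'e::euclidean_space set \<Rightarrow> ('e \<Rightarrow> 'f::real_normed_vector) \<Rightarrow> bool" where
  "smooth_on S f \<longleftrightarrow> (\<forall>k. Ck_on k S f)"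

text \<open>The manifold is the whole type \<open>'a\<close> with its topology. A chart is a pair of an open domain
  and a coordinate map into the model space \<open>'e\<close>; the values of the coordinate map outside the
  domain are irrelevant. The atlas need not be maximal.\<close>

type_synonym ('a, 'e) chart = "'a set \<times> ('a \<Rightarrow> 'e)"

abbreviation chart_inv :: "'a set \<Rightarrow> ('a \<Rightarrow> 'e) \<Rightarrow> 'e \<Rightarrow> 'a" where
  "chart_inv U x \<equiv> inv_into U x"

definition smooth_manifold ::
  "('a::{t2_space,second_countable_topology}, 'e::euclidean_space) chart set \<Rightarrow> bool" where
  "smooth_manifold A \<longleftrightarrow>
     connected (UNIV :: 'a set) \<and>
     (\<Union>(U, x)\<in>A. U) = UNIV \<and>
     (\<forall>(U, x)\<in>A. open U \<and> open (x ` U) \<and> homeomorphism U (x ` U) x (chart_inv U x)) \<and>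
     (\<forall>(U, x)\<in>A. \<forall>(V, y)\<in>A. smooth_on (x ` (U \<inter> V)) (y \<circ> chart_inv U x))"

definition smooth_functions :: "('a, 'e::euclidean_space) chart set \<Rightarrow> ('a \<Rightarrow> real) set" where
  "smooth_functions A = {f. \<forall>(U, x)\<in>A. smooth_on (x ` U) (f \<circ> chart_inv U x)}"

text \<open>A tangent vector at \<open>p\<close> is a directional derivative operator at \<open>p\<close> acting on smooth
  functions, i.e. \<open>\<Sum>i. u\<^sup>i \<partial>/\<partial>x\<^sup>i\<close> at \<open>p\<close> for a chart \<open>x\<close> around \<open>p\<close>. Operators are set to \<open>0\<close> on
  nonsmooth functions, so that equality of operators is equality of tangent vectors and the vector
  space operations are the pointwise ones.\<close>

type_synonym 'a tangent = "('a \<Rightarrow> real) \<Rightarrow> real"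
type_synonym 'a vector_field = "'a \<Rightarrow> 'a tangent"

definition coord_vector ::
  "('a, 'e::euclidean_space) chart set \<Rightarrow> ('a, 'e) chart \<Rightarrow> 'a \<Rightarrow> 'e \<Rightarrow> 'a tangent" where
  "coord_vector A c p u = (case c of (U, x) \<Rightarrow>
     (\<lambda>f. if f \<in> smooth_functions A
          then frechet_derivative (f \<circ> chart_inv U x) (at (x p)) u else 0))"

definition charts_at :: "('a, 'e) chart set \<Rightarrow> 'a \<Rightarrow> ('a, 'e) chart set" where
  "charts_at A p = {c \<in> A. p \<in> fst c}"

definition tangent_space :: "('a, 'e::euclidean_space) chart set \<Rightarrow> 'a \<Rightarrow> 'a tangent set" where
  "tangent_space A p = {coord_vector A c p u | c u. c \<in> charts_at A p}"

definition scale_tangent :: "real \<Rightarrow> 'a tangent \<Rightarrow> 'a tangent" (infixr "\<cdot>\<^sub>t" 75) where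
  "a \<cdot>\<^sub>t v = (\<lambda>f. a * v f)"

definition scale_field :: "('a \<Rightarrow> real) \<Rightarrow> 'a vector_field \<Rightarrow> 'a vector_field" (infixr "\<cdot>\<^sub>f" 75) where
  "h \<cdot>\<^sub>f X = (\<lambda>p. h p \<cdot>\<^sub>t X p)"

definition lie_deriv :: "'a vector_field \<Rightarrow> ('a \<Rightarrow> real) \<Rightarrow> 'a \<Rightarrow> real" where
  "lie_deriv X f = (\<lambda>p. X p f)"

definition vector_fields :: "('a, 'e::euclidean_space) chart set \<Rightarrow> 'a vector_field set" where
  "vector_fields A = {X. (\<forall>p. X p \<in> tangent_space A p) \<and>
     (\<forall>f\<in>smooth_functions A. lie_deriv X f \<in> smooth_functions A)}"

definition lie_bracket :: "'a vector_field \<Rightarrow> 'a vector_field \<Rightarrow> 'a vector_field" where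
  "lie_bracket X Y = (\<lambda>p f. X p (lie_deriv Y f) - Y p (lie_deriv X f))"

text \<open>Tensor fields are families of multilinear maps on the tangent spaces which are smooth when
  evaluated on smooth vector fields.\<close>

type_synonym 'a covector_field = "'a \<Rightarrow> 'a tangent \<Rightarrow> real"
type_synonym 'a endo_field = "'a \<Rightarrow> 'a tangent \<Rightarrow> 'a tangent"
type_synonym 'a bilinear_field = "'a \<Rightarrow> 'a tangent \<Rightarrow> 'a tangent \<Rightarrow> real"

definition ap :: "('a \<Rightarrow> 'a tangent \<Rightarrow> 'b) \<Rightarrow> 'a vector_field \<Rightarrow> 'a \<Rightarrow> 'b" where
  "ap t X = (\<lambda>p. t p (X p))"

definition ap2 :: "'a bilinear_field \<Rightarrow> 'a vector_field \<Rightarrow> 'a vector_field \<Rightarrow> 'a \<Rightarrow> real" where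
  "ap2 g X Y = (\<lambda>p. g p (X p) (Y p))"

definition one_form :: "('a, 'e::euclidean_space) chart set \<Rightarrow> 'a covector_field \<Rightarrow> bool" where
  "one_form A \<eta> \<longleftrightarrow>
     (\<forall>p. \<forall>v\<in>tangent_space A p. \<forall>w\<in>tangent_space A p. \<forall>a.
        \<eta> p (v + w) = \<eta> p v + \<eta> p w \<and> \<eta> p (a \<cdot>\<^sub>t v) = a * \<eta> p v) \<and>
     (\<forall>X\<in>vector_fields A. ap \<eta> X \<in> smooth_functions A)"

definition tensor_field_1_1 :: "('a, 'e::euclidean_space) chart set \<Rightarrow> 'a endo_field \<Rightarrow> bool" where
  "tensor_field_1_1 A \<phi> \<longleftrightarrow>
     (\<forall>p. \<forall>v\<in>tangent_space A p. \<forall>w\<in>tangent_space A p. \<forall>a.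
        \<phi> p v \<in> tangent_space A p \<and>
        \<phi> p (v + w) = \<phi> p v + \<phi> p w \<and> \<phi> p (a \<cdot>\<^sub>t v) = a \<cdot>\<^sub>t \<phi> p v) \<and>
     (\<forall>X\<in>vector_fields A. ap \<phi> X \<in> vector_fields A)"

definition riemannian_metric ::
  "('a, 'e::euclidean_space) chart set \<Rightarrow> 'a bilinear_field \<Rightarrow> bool" where
  "riemannian_metric A g \<longleftrightarrow>
     (\<forall>p. \<forall>u\<in>tangent_space A p. \<forall>v\<in>tangent_space A p. \<forall>w\<in>tangent_space A p. \<forall>a.
        g p (u + v) w = g p u w + g p v w \<and> g p (a \<cdot>\<^sub>t u) w = a * g p u w \<and>
        g p u v = g p v u \<and> (u \<noteq> 0 \<longrightarrow> g p u u > 0)) \<and>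
     (\<forall>X\<in>vector_fields A. \<forall>Y\<in>vector_fields A. ap2 g X Y \<in> smooth_functions A)"

type_synonym 'a connection = "'a vector_field \<Rightarrow> 'a vector_field \<Rightarrow> 'a vector_field"

definition affine_connection ::
  "('a, 'e::euclidean_space) chart set \<Rightarrow> 'a connection \<Rightarrow> bool" where
  "affine_connection A D \<longleftrightarrow>
     (\<forall>X\<in>vector_fields A. \<forall>Y\<in>vector_fields A. \<forall>Z\<in>vector_fields A. \<forall>h\<in>smooth_functions A.
        D X Y \<in> vector_fields A \<and>
        D (X + Y) Z = D X Z + D Y Z \<and>
        D (h \<cdot>\<^sub>f X) Y = h \<cdot>\<^sub>f D X Y \<and>
        D X (Y + Z) = D X Y + D X Z \<and>
        D X (h \<cdot>\<^sub>f Y) = h \<cdot>\<^sub>f D X Y + lie_deriv X h \<cdot>\<^sub>f Y)"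

definition levi_civita ::
  "('a, 'e::euclidean_space) chart set \<Rightarrow> 'a bilinear_field \<Rightarrow> 'a connection \<Rightarrow> bool" where
  "levi_civita A g D \<longleftrightarrow> affine_connection A D \<and>
     (\<forall>X\<in>vector_fields A. \<forall>Y\<in>vector_fields A. D X Y - D Y X = lie_bracket X Y) \<and>
     (\<forall>X\<in>vector_fields A. \<forall>Y\<in>vector_fields A. \<forall>Z\<in>vector_fields A.
        lie_deriv X (ap2 g Y Z) = ap2 g (D X Y) Z + ap2 g Y (D X Z))"

definition curvature :: "'a connection \<Rightarrow>
    'a vector_field \<Rightarrow> 'a vector_field \<Rightarrow> 'a vector_field \<Rightarrow> 'a vector_field" where
  "curvature D X Y Z = D X (D Y Z) - D Y (D X Z) - D (lie_bracket X Y) Z"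

text \<open>In \<open>trace_at\<close> the trace does not depend on the chosen chart.\<close>

definition coords ::
  "('a, 'e::euclidean_space) chart set \<Rightarrow> ('a, 'e) chart \<Rightarrow> 'a \<Rightarrow> 'a tangent \<Rightarrow> 'e" where
  "coords A c p v = (THE u. v = coord_vector A c p u)"

definition trace_at ::
  "('a, 'e::euclidean_space) chart set \<Rightarrow> 'a \<Rightarrow> ('a tangent \<Rightarrow> 'a tangent) \<Rightarrow> real" where
  "trace_at A p F = (let c = (SOME c. c \<in> charts_at A p) in
     \<Sum>i\<in>Basis. coords A c p (F (coord_vector A c p i)) \<bullet> i)"

text \<open>\<open>R(X,Y)Z\<close> is tensorial, so its value at \<open>p\<close> depends on \<open>X\<close> only through \<open>X p\<close>; hence the choice
  of extension below is immaterial and the Ricci tensor at \<open>p\<close> is the trace of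
  \<open>v \<mapsto> R(v,Y)Z\<close> on the tangent space at \<open>p\<close>.\<close>

definition extension ::
  "('a, 'e::euclidean_space) chart set \<Rightarrow> 'a \<Rightarrow> 'a tangent \<Rightarrow> 'a vector_field" where
  "extension A p v = (SOME V. V \<in> vector_fields A \<and> V p = v)"

definition ricci :: "('a, 'e::euclidean_space) chart set \<Rightarrow> 'a connection \<Rightarrow>
    'a vector_field \<Rightarrow> 'a vector_field \<Rightarrow> 'a \<Rightarrow> real" where
  "ricci A D Y Z = (\<lambda>p. trace_at A p (\<lambda>v. curvature D (extension A p v) Y Z p))"

definition einstein ::
  "('a, 'e::euclidean_space) chart set \<Rightarrow> 'a bilinear_field \<Rightarrow> 'a connection \<Rightarrow> bool" where
  "einstein A g D \<longleftrightarrow> (\<exists>c::real. \<forall>Y\<in>vector_fields A. \<forall>Z\<in>vector_fields A. \<forall>p.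
     ricci A D Y Z p = c * g p (Y p) (Z p))"

definition nabla_ricci :: "('a, 'e::euclidean_space) chart set \<Rightarrow> 'a connection \<Rightarrow>
    'a vector_field \<Rightarrow> 'a vector_field \<Rightarrow> 'a vector_field \<Rightarrow> 'a \<Rightarrow> real" where
  "nabla_ricci A D X Y Z =
     lie_deriv X (ricci A D Y Z) - ricci A D (D X Y) Z - ricci A D Y (D X Z)"

definition special_weakly_ricci_symmetric ::
  "('a, 'e::euclidean_space) chart set \<Rightarrow> 'a connection \<Rightarrow> bool" where
  "special_weakly_ricci_symmetric A D \<longleftrightarrow> (\<exists>\<rho>. one_form A \<rho> \<and>
     (\<forall>X\<in>vector_fields A. \<forall>Y\<in>vector_fields A. \<forall>Z\<in>vector_fields A. \<forall>p.
        nabla_ricci A D X Y Z p =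
          2 * \<rho> p (X p) * ricci A D Y Z p + \<rho> p (Y p) * ricci A D Z X p
          + \<rho> p (Z p) * ricci A D X Y p))"

definition almost_contact_metric ::
  "nat \<Rightarrow> ('a::{t2_space,second_countable_topology}, 'e::euclidean_space) chart set \<Rightarrow> 'a endo_field \<Rightarrow>
    'a vector_field \<Rightarrow> 'a covector_field \<Rightarrow> 'a bilinear_field \<Rightarrow> bool" where
  "almost_contact_metric n A \<phi> \<xi> \<eta> g \<longleftrightarrow>
     n \<ge> 1 \<and> DIM('e) = 2 * n + 1 \<and>
     smooth_manifold A \<and> tensor_field_1_1 A \<phi> \<and> \<xi> \<in> vector_fields A \<and> one_form A \<eta> \<and>
     riemannian_metric A g \<and>
     (\<forall>X\<in>vector_fields A. ap \<phi> (ap \<phi> X) = - X + ap \<eta> X \<cdot>\<^sub>f \<xi>) \<and>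
     ap \<eta> \<xi> = 1 \<and>
     (\<forall>X\<in>vector_fields A. ap \<eta> (ap \<phi> X) = 0) \<and>
     ap \<phi> \<xi> = 0 \<and>
     (\<forall>X\<in>vector_fields A. ap \<eta> X = ap2 g X \<xi>) \<and>
     (\<forall>X\<in>vector_fields A. \<forall>Y\<in>vector_fields A.
        ap2 g (ap \<phi> X) (ap \<phi> Y) = ap2 g X Y - ap \<eta> X * ap \<eta> Y)"

definition nabla_endo ::
  "'a connection \<Rightarrow> 'a endo_field \<Rightarrow> 'a vector_field \<Rightarrow> 'a vector_field \<Rightarrow> 'a vector_field" where
  "nabla_endo D \<phi> X Y = D X (ap \<phi> Y) - ap \<phi> (D X Y)"

definition beta_kenmotsu ::
  "nat \<Rightarrow> ('a::{t2_space,second_countable_topology}, 'e::euclidean_space) chart set \<Rightarrow> 'a endo_field \<Rightarrow>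
    'a vector_field \<Rightarrow> 'a covector_field \<Rightarrow> 'a bilinear_field \<Rightarrow> 'a connection \<Rightarrow> real \<Rightarrow> bool" where
  "beta_kenmotsu n A \<phi> \<xi> \<eta> g D \<beta> \<longleftrightarrow>
     \<beta> > 0 \<and> almost_contact_metric n A \<phi> \<xi> \<eta> g \<and> levi_civita A g D \<and>
     (\<forall>X\<in>vector_fields A. \<forall>Y\<in>vector_fields A.
        nabla_endo D \<phi> X Y =
          (\<lambda>_. \<beta>) \<cdot>\<^sub>f (ap2 g (ap \<phi> X) Y \<cdot>\<^sub>f \<xi> - ap \<eta> Y \<cdot>\<^sub>f ap \<phi> X))"

end

theory Submission
  imports Defs "HOL-Computational_Algebra.Polynomial"
begin

text \<open>The Kenmotsu condition gives \<open>\<nabla>\<^sub>X \<xi> = \<beta> (X - \<eta>(X) \<xi>)\<close>, hence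
  \<open>R(X,Y)\<xi> = \<beta>\<^sup>2 (\<eta>(X) Y - \<eta>(Y) X)\<close> and \<open>S(X,\<xi>) = - K \<eta>(X)\<close> with \<open>K = 2 n \<beta>\<^sup>2 > 0\<close>. Therefore
  \<open>(\<nabla>\<^sub>X S)(Y,\<xi>) = - K \<beta> g(X,Y) - \<beta> S(Y,X)\<close>, and special weak Ricci symmetry equates this with
  \<open>2 \<rho>(X) S(Y,\<xi>) + \<rho>(Y) S(\<xi>,X) + \<rho>(\<xi>) S(X,Y)\<close>. The left side vanishes for \<open>X = \<xi>\<close>; so \<open>Y = \<xi>\<close>
  yields \<open>\<rho>(\<xi>) = 0\<close>, then an arbitrary \<open>Y\<close> yields \<open>\<rho> = 0\<close>, and what remains is \<open>S = - K g\<close>.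

  Since the Ricci tensor is defined by extending tangent vectors to global fields and by coordinates
  of operators, bump functions are needed to produce the extensions and to make the coordinates
  unique.\<close>

section \<open>Calculus of iterated differentiability\<close>

lemma Ck_on_subset: "Ck_on k S f \<Longrightarrow> T \<subseteq> S \<Longrightarrow> Ck_on k T f"
  by (induction k arbitrary: f) (auto intro: continuous_on_subset)

lemma Ck_on_Un:
  "open S \<Longrightarrow> open T \<Longrightarrow> Ck_on k S f \<Longrightarrow> Ck_on k T f \<Longrightarrow> Ck_on k (S \<union> T) f"
  by (induction k arbitrary: f) (auto intro: continuous_on_open_Un)

lemma differentiable_on_imp_continuous_on_at:
  "\<forall>x\<in>S. f differentiable (at x) \<Longrightarrow> continuous_on S f"
  by (meson continuous_at_imp_continuous_on differentiable_imp_continuous_within)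

lemma Ck_on_SucD: "Ck_on (Suc k) S f \<Longrightarrow> Ck_on k S f"
proof (induction k arbitrary: f)
  case 0
  then show ?case by (simp add: differentiable_on_imp_continuous_on_at)
next
  case (Suc k)
  then show ?case by (metis Ck_on.simps(2))
qed

text \<open>\<open>frechet_derivative\<close> chooses among all derivatives at the point. Functions
  that agree near the point have the same derivatives, so the choices agree even where no derivative
  exists.\<close>

lemma frechet_derivative_cong_open:
  assumes "open S" "x \<in> S" "\<And>y. y \<in> S \<Longrightarrow> f y = g y"
  shows "frechet_derivative f (at x) = frechet_derivative g (at x)"
proof -
  have "(f has_derivative F) (at x) \<longleftrightarrow> (g has_derivative F) (at x)" for F
    using assms has_derivative_transform_within_open[OF _ assms(1,2), of f F UNIV g]
      has_derivative_transform_within_open[OF _ assms(1,2), of g F UNIV f] by auto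
  then show ?thesis by (simp add: frechet_derivative_def)
qed

lemma differentiable_cong_open:
  assumes "open S" "x \<in> S" "\<And>y. y \<in> S \<Longrightarrow> f y = g y" "f differentiable (at x)"
  shows "g differentiable (at x)"
  using assms has_derivative_transform_within_open[OF _ assms(1,2), of f _ UNIV g]
  unfolding differentiable_def by blast

lemma Ck_on_cong:
  assumes "open S" "\<And>x. x \<in> S \<Longrightarrow> f x = g x" "Ck_on k S f"
  shows "Ck_on k S g"
  using assms(2,3)
proof (induction k arbitrary: f g)
  case 0
  then show ?case using continuous_on_eq by fastforce
next
  case (Suc k)
  have "g differentiable (at x)" if "x \<in> S" for x
    using Suc.prems that differentiable_cong_open[OF assms(1) that, of f g] by auto
  moreover have "Ck_on k S (\<lambda>x. frechet_derivative g (at x) i)" if "i \<in> Basis" for i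
  proof (rule Suc.IH)
    show "Ck_on k S (\<lambda>x. frechet_derivative f (at x) i)" using Suc.prems that by auto
  qed (metis Suc.prems(1) assms(1) frechet_derivative_cong_open)
  ultimately show ?case by auto
qed

text \<open>Lets the derivative be supplied by an explicit formula; uniqueness of derivatives
  identifies it with \<open>frechet_derivative\<close> on the open set.\<close>

lemma Ck_on_SucI:
  assumes "open S"
    and "\<And>x. x \<in> S \<Longrightarrow> (f has_derivative f' x) (at x)"
    and "\<And>i. i \<in> Basis \<Longrightarrow> Ck_on k S (\<lambda>x. f' x i)"
  shows "Ck_on (Suc k) S f"
proof -
  have "Ck_on k S (\<lambda>x. frechet_derivative f (at x) i)" if "i \<in> Basis" for i
    by (rule Ck_on_cong[OF assms(1) _ assms(3)[OF that]])
      (metis assms(2) frechet_derivative_at)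
  then show ?thesis using assms(2) by (auto simp: differentiable_def)
qed

lemma Ck_on_has_derivative:
  assumes "Ck_on (Suc k) S f" "x \<in> S"
  shows "(f has_derivative frechet_derivative f (at x)) (at x)"
  using assms frechet_derivative_works by auto

lemma Ck_on_const [simp]: "Ck_on k S (\<lambda>x. c)"
  by (induction k arbitrary: c) auto

lemma Ck_on_bounded_linear:
  assumes "bounded_linear L" "open S"
  shows "Ck_on k S L"
proof (cases k)
  case 0
  then show ?thesis using assms by (auto simp: linear_continuous_on)
next
  case (Suc m)
  show ?thesis unfolding Suc
    by (rule Ck_on_SucI[OF assms(2) bounded_linear_imp_has_derivative[OF assms(1)]]) auto
qed

lemma Ck_on_add:
  assumes "open S" "Ck_on k S f" "Ck_on k S g"
  shows "Ck_on k S (\<lambda>x. f x + g x)"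
  using assms(2,3)
proof (induction k arbitrary: f g)
  case 0
  then show ?case by (auto intro: continuous_on_add)
next
  case (Suc k)
  show ?case
    by (rule Ck_on_SucI[OF assms(1)
          has_derivative_add[OF Ck_on_has_derivative[OF Suc.prems(1)]
            Ck_on_has_derivative[OF Suc.prems(2)]]])
      (use Suc in auto)
qed

lemma Ck_on_sum:
  assumes "open S" "\<And>i. i \<in> I \<Longrightarrow> Ck_on k S (f i)"
  shows "Ck_on k S (\<lambda>x. \<Sum>i\<in>I. f i x)"
  using assms(2)
proof (induction I rule: infinite_finite_induct)
  case (insert i I)
  then show ?case using Ck_on_add[OF assms(1), of k "f i"] by simp
qed simp_all

text \<open>By the product rule the derivative is a sum of two terms of the same bilinear form. The
  undifferentiated factor is lowered by one order with \<open>Ck_on_SucD\<close>, so the induction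
  has to run over all pairs of factors.\<close>

lemma Ck_on_bounded_bilinear:
  fixes f :: "'e::euclidean_space \<Rightarrow> 'f::real_normed_vector"
    and g :: "'e \<Rightarrow> 'g::real_normed_vector" and m :: "'f \<Rightarrow> 'g \<Rightarrow> 'h::real_normed_vector"
  assumes "bounded_bilinear m" "open S" "Ck_on k S f" "Ck_on k S g"
  shows "Ck_on k S (\<lambda>x. m (f x) (g x))"
  using assms(3,4)
proof (induction k arbitrary: f g)
  case 0
  then show ?case by (auto intro: bounded_bilinear.continuous_on[OF assms(1)])
next
  case (Suc k)
  show ?case
  proof (rule Ck_on_SucI[OF assms(2)
        bounded_bilinear.FDERIV[OF assms(1) Ck_on_has_derivative[OF Suc.prems(1)]
          Ck_on_has_derivative[OF Suc.prems(2)]]], assumption, assumption)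
    fix i :: 'e assume i: "i \<in> Basis"
    have "Ck_on k S (\<lambda>x. frechet_derivative f (at x) i)" "Ck_on k S (\<lambda>x. frechet_derivative g (at x) i)"
      using Suc.prems i by simp_all
    with Suc.prems[THEN Ck_on_SucD]
    show "Ck_on k S (\<lambda>x. m (f x) (frechet_derivative g (at x) i)
        + m (frechet_derivative f (at x) i) (g x))"
      by (intro Ck_on_add assms(2) Suc.IH)
  qed
qed

text \<open>Reduces arbitrary directions to basis directions, the only ones along which
  \<open>Ck_on\<close> controls derivatives.\<close>

lemma linear_basis_expansion:
  assumes "linear L"
  shows "L w = (\<Sum>j\<in>Basis. (w \<bullet> j) *\<^sub>R L j)"
proof -
  have "L w = L (\<Sum>j\<in>Basis. (w \<bullet> j) *\<^sub>R j)" by (simp add: euclidean_representation)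
  then show ?thesis by (simp add: linear_sum[OF assms] linear_scale[OF assms])
qed

text \<open>The chain rule is expanded in the basis of the middle space. The derivative becomes a
  finite sum of products whose factors are partial derivatives of \<open>g\<close> and partial
  derivatives of \<open>f\<close> composed with \<open>g\<close>; the induction hypothesis handles
  the latter, with \<open>g\<close> fixed and the outer function arbitrary.\<close>

lemma Ck_on_compose:
  fixes g :: "'e::euclidean_space \<Rightarrow> 'f::euclidean_space" and f :: "'f \<Rightarrow> 'h::real_normed_vector"
  assumes "open S" "Ck_on k S g" "Ck_on k T f" "g ` S \<subseteq> T"
  shows "Ck_on k S (\<lambda>x. f (g x))"
  using assms(2,3)
proof (induction k arbitrary: f)
  case 0
  then show ?case using assms(4) continuous_on_compose2[of T f S g] by auto
next
  case (Suc k)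
  have d: "((\<lambda>x. f (g x)) has_derivative
      (\<lambda>v. \<Sum>j\<in>Basis. (frechet_derivative g (at x) v \<bullet> j) *\<^sub>R frechet_derivative f (at (g x)) j)) (at x)"
    if "x \<in> S" for x
  proof -
    have gx: "(g has_derivative frechet_derivative g (at x)) (at x)"
      using Ck_on_has_derivative Suc.prems(1) that by blast
    have fx: "(f has_derivative frechet_derivative f (at (g x))) (at (g x))"
      using Ck_on_has_derivative[OF Suc.prems(2)] that assms(4) by blast
    show ?thesis
      by (rule has_derivative_eq_rhs[OF has_derivative_compose[OF gx fx]])
        (rule ext, rule linear_basis_expansion[OF has_derivative_linear[OF fx]])
  qed
  show ?case
  proof (rule Ck_on_SucI[OF assms(1) d], assumption)
    fix i :: 'e assume i: "i \<in> Basis"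
    have g': "Ck_on k S (\<lambda>x. frechet_derivative g (at x) i \<bullet> j)" for j
      by (rule Ck_on_bounded_bilinear[OF bounded_bilinear_inner assms(1)])
        (use Suc.prems(1) i in auto)
    have f': "Ck_on k S (\<lambda>x. frechet_derivative f (at (g x)) j)" if "j \<in> Basis" for j
      using Suc.IH[OF Ck_on_SucD[OF Suc.prems(1)], of "\<lambda>y. frechet_derivative f (at y) j"]
        Suc.prems(2) that by auto
    show "Ck_on k S (\<lambda>x. \<Sum>j\<in>Basis. (frechet_derivative g (at x) i \<bullet> j) *\<^sub>R
        frechet_derivative f (at (g x)) j)"
      by (intro Ck_on_sum assms(1) Ck_on_bounded_bilinear[OF bounded_bilinear_scaleR] g' f')
  qed
qed

section \<open>Closure properties of smooth maps between Euclidean spaces\<close>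

lemma smooth_on_differentiable: "smooth_on S f \<Longrightarrow> x \<in> S \<Longrightarrow> f differentiable (at x)"
  unfolding smooth_on_def using Ck_on.simps(2) by blast

lemma smooth_on_subset: "smooth_on S f \<Longrightarrow> T \<subseteq> S \<Longrightarrow> smooth_on T f"
  unfolding smooth_on_def using Ck_on_subset by blast

lemma smooth_on_Un:
  "open S \<Longrightarrow> open T \<Longrightarrow> smooth_on S f \<Longrightarrow> smooth_on T f \<Longrightarrow> smooth_on (S \<union> T) f"
  unfolding smooth_on_def using Ck_on_Un by blast

lemma smooth_on_cong:
  "open S \<Longrightarrow> (\<And>x. x \<in> S \<Longrightarrow> f x = g x) \<Longrightarrow> smooth_on S f \<Longrightarrow> smooth_on S g"
  unfolding smooth_on_def using Ck_on_cong by blast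

lemma smooth_on_const [simp]: "smooth_on S (\<lambda>x. c)"
  unfolding smooth_on_def by simp

lemma smooth_on_ident: "open S \<Longrightarrow> smooth_on S (\<lambda>x. x)"
  unfolding smooth_on_def using Ck_on_bounded_linear[OF bounded_linear_ident] by blast

lemma smooth_on_add:
  "open S \<Longrightarrow> smooth_on S f \<Longrightarrow> smooth_on S g \<Longrightarrow> smooth_on S (\<lambda>x. f x + g x)"
  unfolding smooth_on_def using Ck_on_add by blast

lemma smooth_on_bounded_bilinear:
  "bounded_bilinear m \<Longrightarrow> open S \<Longrightarrow> smooth_on S f \<Longrightarrow> smooth_on S g \<Longrightarrow>
    smooth_on S (\<lambda>x. m (f x) (g x))"
  unfolding smooth_on_def using Ck_on_bounded_bilinear by blast

lemmas smooth_on_mult = smooth_on_bounded_bilinear[OF bounded_bilinear_mult]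
lemmas smooth_on_inner = smooth_on_bounded_bilinear[OF bounded_bilinear_inner]

lemma smooth_on_diff:
  assumes "open S" "smooth_on S f" "smooth_on S g"
  shows "smooth_on S (\<lambda>x. f x - g x)"
  using smooth_on_add[OF assms(1,2) smooth_on_bounded_bilinear[OF bounded_bilinear_scaleR assms(1)
        smooth_on_const[of S "-1"] assms(3)]]
  by simp

lemma smooth_on_compose:
  fixes g :: "'e::euclidean_space \<Rightarrow> 'f::euclidean_space"
  assumes "open S" "smooth_on S g" "smooth_on T f" "g ` S \<subseteq> T"
  shows "smooth_on S (\<lambda>x. f (g x))"
  using assms Ck_on_compose unfolding smooth_on_def by blast

text \<open>A fixed direction is a combination of basis directions with constant coefficients. Order
  \<open>k\<close> of the derivative comes from order \<open>Suc k\<close> of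
  \<open>f\<close>.\<close>

lemma smooth_on_frechet_derivative:
  fixes f :: "'e::euclidean_space \<Rightarrow> 'f::real_normed_vector"
  assumes "open S" "smooth_on S f"
  shows "smooth_on S (\<lambda>x. frechet_derivative f (at x) u)"
proof -
  have *: "frechet_derivative f (at x) u
      = (\<Sum>i\<in>Basis. (u \<bullet> i) *\<^sub>R frechet_derivative f (at x) i)" if "x \<in> S" for x
    by (rule linear_basis_expansion[OF linear_frechet_derivative[OF
            smooth_on_differentiable[OF assms(2) that]]])
  have sum: "Ck_on k S (\<lambda>x. \<Sum>i\<in>Basis. (u \<bullet> i) *\<^sub>R frechet_derivative f (at x) i)" for k
    using assms(2)
    by (intro Ck_on_sum assms(1) Ck_on_bounded_bilinear[OF bounded_bilinear_scaleR])
      (auto simp: smooth_on_def dest: spec[of _ "Suc k"])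
  show ?thesis
    unfolding smooth_on_def by (intro allI Ck_on_cong[OF assms(1) *[symmetric] sum])
qed

section \<open>Bump functions\<close>

text \<open>Functions of this shape are closed under differentiation, with \<open>P\<close> replaced by
  \<open>t\<^sup>2 (P - P')\<close>; this makes all of them smooth at once.\<close>

definition flat_exp :: "real poly \<Rightarrow> real \<Rightarrow> real" where
  "flat_exp P x = (if x > 0 then poly P (inverse x) * exp (- inverse x) else 0)"

lemma poly_div_exp_tendsto_0: "((\<lambda>x. poly P x * exp (- x)) \<longlongrightarrow> (0::real)) at_top"
proof -
  have "((\<lambda>x::real. \<Sum>i\<le>degree P. coeff P i * (x ^ i / exp x)) \<longlongrightarrow> (\<Sum>i\<le>degree P. coeff P i * 0)) at_top"
    by (intro tendsto_intros tendsto_power_div_exp_0)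
  then show ?thesis
    by (simp add: poly_altdef exp_minus divide_inverse sum_distrib_right mult.assoc)
qed

lemma flat_exp_has_derivative:
  "(flat_exp P has_real_derivative flat_exp ([:0,0,1:] * (P - pderiv P)) x) (at x)"
proof -
  consider "x > 0" | "x < 0" | "x = 0" by linarith
  then show ?thesis
  proof cases
    case 1
    have "((\<lambda>x. poly P (inverse x) * exp (- inverse x)) has_real_derivative
        flat_exp ([:0,0,1:] * (P - pderiv P)) x) (at x)"
      using 1 by (auto intro!: derivative_eq_intros DERIV_chain2[OF poly_DERIV]
          simp: flat_exp_def power2_eq_square algebra_simps)
    then show ?thesis
      by (rule has_field_derivative_transform_within_open[of _ _ _ "{0<..}"])
        (use 1 in \<open>auto simp: flat_exp_def\<close>)
  next
    case 2
    have "((\<lambda>x. 0) has_real_derivative flat_exp ([:0,0,1:] * (P - pderiv P)) x) (at x)"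
      using 2 by (auto simp: flat_exp_def)
    then show ?thesis
      by (rule has_field_derivative_transform_within_open[of _ _ _ "{..<0}"])
        (use 2 in \<open>auto simp: flat_exp_def\<close>)
  next
    case 3
    have "((\<lambda>h. flat_exp P h / h) \<longlongrightarrow> 0) (at_left 0)"
      by (rule tendsto_eventually)
        (auto simp: flat_exp_def eventually_at_filter)
    moreover have "((\<lambda>h. flat_exp P h / h) \<longlongrightarrow> 0) (at_right 0)"
    proof (rule Lim_transform_eventually)
      \<comment> \<open>With t = 1/h, dividing by h multiplies the polynomial in t by t, which is
        \<open>pCons 0 P\<close>; as h decreases to 0, t tends to infinity and the exponential
        wins.\<close>
      show "((\<lambda>h. poly (pCons 0 P) (inverse h) * exp (- inverse h)) \<longlongrightarrow> 0) (at_right (0::real))"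
        by (rule filterlim_compose[OF poly_div_exp_tendsto_0 filterlim_inverse_at_top_right])
      show "\<forall>\<^sub>F h in at_right 0. poly (pCons 0 P) (inverse h) * exp (- inverse h) = flat_exp P h / h"
        by (auto simp: flat_exp_def divide_inverse eventually_at_filter)
    qed
    ultimately have "((\<lambda>h. flat_exp P h / h) \<longlongrightarrow> 0) (at 0)"
      by (simp add: filterlim_split_at)
    then show ?thesis using 3 by (simp add: DERIV_def flat_exp_def)
  qed
qed

lemma smooth_on_flat_exp: "smooth_on UNIV (flat_exp P)"
proof -
  have "Ck_on k UNIV (flat_exp P)" for k
  proof (induction k arbitrary: P)
    case 0
    then show ?case
      using DERIV_isCont[OF flat_exp_has_derivative] by (simp add: continuous_on_eq_continuous_at)
  next
    case (Suc k)
    show ?case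
      by (rule Ck_on_SucI[OF open_UNIV flat_exp_has_derivative[unfolded has_field_derivative_def]])
        (use Suc in simp)
  qed
  then show ?thesis unfolding smooth_on_def by blast
qed

lemma bump_exists:
  fixes z :: "'e::euclidean_space"
  assumes "r > 0"
  obtains h :: "'e \<Rightarrow> real" where "smooth_on UNIV h" "h z = 1" "\<forall>y. y \<notin> cball z r \<longrightarrow> h y = 0"
proof
  \<comment> \<open>The squared distance is used because, unlike the distance, it is smooth at the
    centre. \<open>flat_exp 1\<close> is exp(-1/s) for s > 0 and 0 otherwise, so the function lives
    on the ball; the constant factor normalises its value at \<open>z\<close>.\<close>
  let ?s = "\<lambda>y. r\<^sup>2 - (y - z) \<bullet> (y - z)"
  let ?h = "\<lambda>y. flat_exp 1 (?s y) * inverse (flat_exp 1 (r\<^sup>2))"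
  have "smooth_on UNIV (\<lambda>y. y - z)"
    by (rule smooth_on_diff[OF open_UNIV smooth_on_ident[OF open_UNIV] smooth_on_const])
  then have "smooth_on UNIV ?s"
    by (intro smooth_on_diff[OF open_UNIV smooth_on_const] smooth_on_inner[OF open_UNIV])
  then have "smooth_on UNIV (\<lambda>y. flat_exp 1 (?s y))"
    by (rule smooth_on_compose[OF open_UNIV _ smooth_on_flat_exp]) simp
  then show "smooth_on UNIV ?h"
    by (rule smooth_on_mult[OF open_UNIV _ smooth_on_const])
  show "?h z = 1" using assms by (simp add: flat_exp_def)
  show "\<forall>y. y \<notin> cball z r \<longrightarrow> ?h y = 0"
  proof (intro allI impI)
    fix y assume "y \<notin> cball z r"
    then have "r < norm (y - z)" by (simp add: dist_norm norm_minus_commute)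
    then have "r\<^sup>2 < (norm (y - z))\<^sup>2" using assms by (intro power_strict_mono) auto
    then have "?s y < 0" by (simp only: power2_norm_eq_inner)
    then show "?h y = 0" unfolding flat_exp_def by simp
  qed
qed

section \<open>Smooth functions and tangent spaces\<close>

lemma frechet_derivative_has_derivative:
  "smooth_on S f \<Longrightarrow> x \<in> S \<Longrightarrow> (f has_derivative frechet_derivative f (at x)) (at x)"
  using frechet_derivative_works smooth_on_differentiable by blast

locale manifold =
  fixes A :: "('a::{t2_space,second_countable_topology}, 'e::euclidean_space) chart set"
  assumes smooth_manifold: "smooth_manifold A"
begin

lemma chart_homeomorphism:
  assumes "(U, x) \<in> A"
  shows "open U" "open (x ` U)" "homeomorphism U (x ` U) x (chart_inv U x)"
  using assms smooth_manifold unfolding smooth_manifold_def by fast+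

lemma chart_inv_chart: "(U, x) \<in> A \<Longrightarrow> q \<in> U \<Longrightarrow> chart_inv U x (x q) = q"
  using chart_homeomorphism(3) homeomorphism_apply1 by blast

lemma transition_smooth:
  assumes "(U, x) \<in> A" "(V, y) \<in> A"
  shows "smooth_on (x ` (U \<inter> V)) (y \<circ> chart_inv U x)"
  using assms smooth_manifold unfolding smooth_manifold_def by fast

text \<open>Inside the open chart image, this set is the preimage of \<open>W\<close> under the
  continuous inverse of the chart.\<close>

lemma open_chart_image:
  assumes "(U, x) \<in> A" "open W"
  shows "open (x ` (U \<inter> W))"
proof -
  have "x ` (U \<inter> W) = x ` U \<inter> chart_inv U x -` W"
    using chart_inv_chart[OF assms(1)] by auto
  moreover have "continuous_on (x ` U) (chart_inv U x)"
    using chart_homeomorphism(3)[OF assms(1)] homeomorphism_cont2 by blast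
  ultimately show ?thesis
    using continuous_open_preimage chart_homeomorphism(2)[OF assms(1)] assms(2) by metis
qed

lemma ex_chart_at: "\<exists>U x. (U, x) \<in> A \<and> p \<in> U"
proof -
  have "(\<Union>(U, x)\<in>A. U) = UNIV" using smooth_manifold unfolding smooth_manifold_def by (elim conjE)
  then have "p \<in> (\<Union>(U, x)\<in>A. U)" by (simp only: UNIV_I)
  then obtain c where "c \<in> A" "p \<in> (case c of (U, x) \<Rightarrow> U)" by (rule UN_E)
  then show ?thesis by (cases c) auto
qed

lemma charts_at_iff: "(U, x) \<in> charts_at A p \<longleftrightarrow> (U, x) \<in> A \<and> p \<in> U"
  by (simp add: charts_at_def)

lemma smooth_functions_iff:
  "f \<in> smooth_functions A \<longleftrightarrow> (\<forall>U x. (U, x) \<in> A \<longrightarrow> smooth_on (x ` U) (f \<circ> chart_inv U x))"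
  unfolding smooth_functions_def by auto

lemma const_smooth: "(\<lambda>p. a) \<in> smooth_functions A"
  by (simp add: smooth_functions_iff o_def)

lemma add_smooth:
  "f \<in> smooth_functions A \<Longrightarrow> h \<in> smooth_functions A \<Longrightarrow> f + h \<in> smooth_functions A"
  by (auto simp: smooth_functions_iff o_def intro: smooth_on_add chart_homeomorphism(2))

lemma mult_smooth:
  "f \<in> smooth_functions A \<Longrightarrow> h \<in> smooth_functions A \<Longrightarrow> f * h \<in> smooth_functions A"
  by (auto simp: smooth_functions_iff o_def intro: smooth_on_mult chart_homeomorphism(2))

text \<open>In any other chart there are two overlapping open pieces: on the part inside
  \<open>U\<close> the function is \<open>f\<close> after a smooth transition map, and off the
  preimage of \<open>K\<close> it is 0. That preimage is compact, hence closed because the manifold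
  is Hausdorff, so the second piece is open.\<close>

lemma zero_extension_smooth:
  assumes U: "(U, x) \<in> A" and f: "smooth_on (x ` U) f"
    and K: "compact K" "K \<subseteq> x ` U" "\<And>y. y \<in> x ` U \<Longrightarrow> y \<notin> K \<Longrightarrow> f y = 0"
  shows "(\<lambda>q. if q \<in> U then f (x q) else 0) \<in> smooth_functions A"
  unfolding smooth_functions_iff
proof (intro allI impI)
  fix V y assume V: "(V, y) \<in> A"
  define N where "N = chart_inv U x ` K"
  have "compact N" unfolding N_def
    using K chart_homeomorphism(3)[OF U] compact_continuous_image continuous_on_subset
      homeomorphism_cont2 by metis
  then have N: "open (- N)" by (simp add: compact_imp_closed open_Compl)
  have NU: "N \<subseteq> U" unfolding N_def using K(2) by (auto intro: inv_into_into)
  let ?F = "(\<lambda>q. if q \<in> U then f (x q) else 0) \<circ> chart_inv V y"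
  note o1 = open_chart_image[OF V chart_homeomorphism(1)[OF U]]
  note o2 = open_chart_image[OF V N]
  have "smooth_on (y ` (V \<inter> U)) (\<lambda>z. f ((x \<circ> chart_inv V y) z))"
    by (rule smooth_on_compose[OF o1 transition_smooth[OF V U] f])
      (auto simp: chart_inv_chart[OF V])
  then have "smooth_on (y ` (V \<inter> U)) ?F"
    by (rule smooth_on_cong[OF o1, rotated]) (auto simp: chart_inv_chart[OF V])
  moreover have "smooth_on (y ` (V \<inter> - N)) ?F"
  proof (rule smooth_on_cong[OF o2 _ smooth_on_const])
    fix z assume "z \<in> y ` (V \<inter> - N)"
    then obtain q where q: "q \<in> V" "q \<notin> N" "z = y q" by auto
    have "f (x q) = 0" if "q \<in> U"
      using q(2) chart_inv_chart[OF U that] that K(3)[of "x q"] unfolding N_def by force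
    then show "0 = ?F z" using q by (simp add: chart_inv_chart[OF V])
  qed
  ultimately have "smooth_on (y ` (V \<inter> U) \<union> y ` (V \<inter> - N)) ?F"
    by (rule smooth_on_Un[OF o1 o2])
  moreover have "y ` (V \<inter> U) \<union> y ` (V \<inter> - N) = y ` V" using NU by auto
  ultimately show "smooth_on (y ` V) ?F" by simp
qed

lemma chart_bump:
  assumes "(U, x) \<in> A" "p \<in> U"
  obtains h K where "smooth_on (x ` U) h" "h (x p) = (1::real)" "compact K" "K \<subseteq> x ` U"
    "\<forall>y. y \<notin> K \<longrightarrow> h y = 0"
proof -
  obtain r where r: "r > 0" "cball (x p) r \<subseteq> x ` U"
    using chart_homeomorphism(2)[OF assms(1)] assms(2) open_contains_cball by blast
  obtain h :: "'e \<Rightarrow> real" where "smooth_on UNIV h" "h (x p) = 1" "\<forall>y. y \<notin> cball (x p) r \<longrightarrow> h y = 0"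
    using bump_exists[OF r(1), of "x p"] .
  with r that[of h "cball (x p) r"] show ?thesis using smooth_on_subset[of UNIV h] by simp
qed

section \<open>Coordinate vectors and tangent spaces\<close>

lemma coord_vector_apply:
  "f \<in> smooth_functions A \<Longrightarrow>
    coord_vector A (U, x) p u f = frechet_derivative (f \<circ> chart_inv U x) (at (x p)) u"
  by (simp add: coord_vector_def)

lemma coord_vector_nonsmooth: "f \<notin> smooth_functions A \<Longrightarrow> coord_vector A (U, x) p u f = 0"
  by (simp add: coord_vector_def)

lemma smooth_has_derivative:
  assumes "f \<in> smooth_functions A" "(U, x) \<in> A" "p \<in> U"
  shows "(f \<circ> chart_inv U x has_derivative frechet_derivative (f \<circ> chart_inv U x) (at (x p)))
    (at (x p))"
  by (rule frechet_derivative_has_derivative[of "x ` U"]) (use assms in \<open>auto simp: smooth_functions_iff\<close>)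

lemma coord_vector_linear:
  assumes "(U, x) \<in> A" "p \<in> U"
  shows "coord_vector A (U, x) p (u + w) = coord_vector A (U, x) p u + coord_vector A (U, x) p w"
    and "coord_vector A (U, x) p (a *\<^sub>R u) = a \<cdot>\<^sub>t coord_vector A (U, x) p u"
proof -
  have "linear (\<lambda>u. coord_vector A (U, x) p u f)" for f
    using has_derivative_linear[OF smooth_has_derivative[OF _ assms, of f]]
    by (cases "f \<in> smooth_functions A")
      (simp_all add: coord_vector_apply coord_vector_nonsmooth linear_zero)
  note lin = linear_add[OF this] linear_scale[OF this]
  show "coord_vector A (U, x) p (u + w) = coord_vector A (U, x) p u + coord_vector A (U, x) p w"
    "coord_vector A (U, x) p (a *\<^sub>R u) = a \<cdot>\<^sub>t coord_vector A (U, x) p u"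
    by (auto simp: lin scale_tangent_def fun_eq_iff)
qed

text \<open>Chain rule for the splitting of \<open>f\<close> in the chart \<open>x\<close> into
  \<open>f\<close> in the chart \<open>y\<close> after the transition map, which holds near
  \<open>x p\<close>. The direction is transformed by the Jacobian of the transition map.\<close>

lemma coord_vector_change:
  assumes U: "(U, x) \<in> A" "p \<in> U" and V: "(V, y) \<in> A" "p \<in> V"
  shows "coord_vector A (U, x) p u
    = coord_vector A (V, y) p (frechet_derivative (y \<circ> chart_inv U x) (at (x p)) u)"
proof
  fix f
  show "coord_vector A (U, x) p u f
    = coord_vector A (V, y) p (frechet_derivative (y \<circ> chart_inv U x) (at (x p)) u) f"
  proof (cases "f \<in> smooth_functions A")
    case f: True
    let ?t = "y \<circ> chart_inv U x" and ?fy = "f \<circ> chart_inv V y"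
    have t: "(?t has_derivative frechet_derivative ?t (at (x p))) (at (x p))"
      by (rule frechet_derivative_has_derivative[OF transition_smooth[OF U(1) V(1)]])
        (use U V in auto)
    have tp: "?t (x p) = y p" using U by (simp add: chart_inv_chart)
    have "(?fy has_derivative frechet_derivative ?fy (at (y p))) (at (?t (x p)))"
      using smooth_has_derivative[OF f V] tp by simp
    from frechet_derivative_at[OF has_derivative_compose[OF t this]]
    have chain: "frechet_derivative (\<lambda>z. ?fy (?t z)) (at (x p))
        = (\<lambda>u. frechet_derivative ?fy (at (y p)) (frechet_derivative ?t (at (x p)) u))" ..
    have "frechet_derivative (\<lambda>z. ?fy (?t z)) (at (x p))
        = frechet_derivative (f \<circ> chart_inv U x) (at (x p))"
      by (rule frechet_derivative_cong_open[OF open_chart_image[OF U(1) chart_homeomorphism(1)[OF V(1)]]])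
        (use U V in \<open>auto simp: chart_inv_chart\<close>)
    with chain show ?thesis by (simp only: coord_vector_apply[OF f])
  qed (simp add: coord_vector_nonsmooth)
qed

text \<open>\<open>tangent_space\<close> collects vectors from all charts at \<open>p\<close>. After
  a change of chart a single one suffices, and the linear structure can be read off from it.\<close>

lemma tangent_space_eq_range:
  assumes "(U, x) \<in> A" "p \<in> U"
  shows "tangent_space A p = range (coord_vector A (U, x) p)"
proof (rule equalityI; rule subsetI)
  fix v assume "v \<in> tangent_space A p"
  then obtain V y u where "(V, y) \<in> A" "p \<in> V" "v = coord_vector A (V, y) p u"
    by (auto simp: tangent_space_def charts_at_def)
  then show "v \<in> range (coord_vector A (U, x) p)"
    using coord_vector_change[OF _ _ assms] by blast
next
  fix v assume "v \<in> range (coord_vector A (U, x) p)"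
  then show "v \<in> tangent_space A p"
    using assms by (auto simp: tangent_space_def charts_at_def)
qed

lemma tangent_space_add:
  assumes "v \<in> tangent_space A p" "w \<in> tangent_space A p"
  shows "v + w \<in> tangent_space A p"
proof -
  obtain U x where c: "(U, x) \<in> A" "p \<in> U" using ex_chart_at by blast
  show ?thesis
    using assms coord_vector_linear(1)[OF c, symmetric] unfolding tangent_space_eq_range[OF c] by auto
qed

lemma tangent_space_scale:
  assumes "v \<in> tangent_space A p"
  shows "a \<cdot>\<^sub>t v \<in> tangent_space A p"
proof -
  obtain U x where c: "(U, x) \<in> A" "p \<in> U" using ex_chart_at by blast
  show ?thesis
    using assms coord_vector_linear(2)[OF c, symmetric] unfolding tangent_space_eq_range[OF c] by auto
qed

lemma tangent_const:
  assumes "v \<in> tangent_space A p"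
  shows "v (\<lambda>q. a) = 0"
  using assms unfolding tangent_space_def
  by (auto simp: coord_vector_def const_smooth o_def frechet_derivative_const)

lemma tangent_const_mult:
  assumes v: "v \<in> tangent_space A p" and f: "f \<in> smooth_functions A"
  shows "v (\<lambda>q. a * f q) = a * v f"
proof -
  obtain U x where c: "(U, x) \<in> A" "p \<in> U" using ex_chart_at by blast
  obtain u where u: "v = coord_vector A (U, x) p u"
    using v unfolding tangent_space_eq_range[OF c] by blast
  have "(\<lambda>q. a * f q) \<in> smooth_functions A"
    using mult_smooth[OF const_smooth f] by (simp add: times_fun_def)
  moreover have "frechet_derivative ((\<lambda>q. a * f q) \<circ> chart_inv U x) (at (x p))
      = (\<lambda>u. a * frechet_derivative (f \<circ> chart_inv U x) (at (x p)) u)"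
    using has_derivative_mult_right[OF smooth_has_derivative[OF f c], of a]
    by (intro frechet_derivative_at[symmetric]) (simp add: o_def)
  ultimately show ?thesis using f by (simp add: u coord_vector_apply)
qed

lemma coord_vector_inj:
  assumes c: "(U, x) \<in> A" "p \<in> U"
  shows "inj (coord_vector A (U, x) p)"
proof (rule injI)
  fix u w assume eq: "coord_vector A (U, x) p u = coord_vector A (U, x) p w"
  obtain h K where h: "smooth_on (x ` U) h" "h (x p) = (1::real)" "compact K" "K \<subseteq> x ` U"
    "\<forall>y. y \<notin> K \<longrightarrow> h y = 0" using chart_bump[OF c] .
  note op = chart_homeomorphism(2)[OF c(1)]
  show "u = w"
  proof (rule euclidean_eqI)
    fix i :: 'e
    txt \<open>A cut-off coordinate function; as its second factor vanishes at \<open>x p\<close>, the derivative of \<open>h\<close>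
      does not enter.\<close>
    let ?f = "\<lambda>y. h y * ((y - x p) \<bullet> i)"
    let ?F = "\<lambda>q. if q \<in> U then ?f (x q) else 0"
    have F: "?F \<in> smooth_functions A"
      by (rule zero_extension_smooth[OF c(1) _ h(3,4)])
        (auto simp: h(5) intro!: smooth_on_mult smooth_on_inner smooth_on_diff smooth_on_ident op h(1))
    have d: "(?f has_derivative (\<lambda>u. u \<bullet> i)) (at (x p))"
      using frechet_derivative_has_derivative[OF h(1), of "x p"] c(2)
      by (auto intro!: derivative_eq_intros simp: h(2))
    have "(?F \<circ> chart_inv U x has_derivative (\<lambda>u. u \<bullet> i)) (at (x p))"
      by (rule has_derivative_transform_within_open[OF d op])
        (use c in \<open>auto simp: chart_inv_chart\<close>)
    from frechet_derivative_at[OF this]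
    have "coord_vector A (U, x) p v ?F = v \<bullet> i" for v
      unfolding coord_vector_apply[OF F] by (rule fun_cong[OF sym])
    from this[of u] this[of w] show "u \<bullet> i = w \<bullet> i" unfolding eq by simp
  qed
qed

text \<open>Injectivity of \<open>coord_vector\<close> makes the definite description in
  \<open>coords\<close> denote, so that \<open>coords\<close> inverts it.\<close>

lemma coords_coord_vector:
  assumes "(U, x) \<in> A" "p \<in> U"
  shows "coords A (U, x) p (coord_vector A (U, x) p u) = u"
  unfolding coords_def using coord_vector_inj[OF assms] by (auto simp: inj_eq)

text \<open>The field with constant coordinates \<open>u\<close> in one chart is multiplied by a
  bump function equal to 1 at \<open>p\<close> and extended by 0.\<close>

lemma ex_vector_field_through:
  assumes "v \<in> tangent_space A p"
  shows "\<exists>V\<in>vector_fields A. V p = v"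
proof -
  obtain U x where c: "(U, x) \<in> A" "p \<in> U" using ex_chart_at by blast
  obtain u where u: "v = coord_vector A (U, x) p u"
    using assms unfolding tangent_space_eq_range[OF c] by blast
  obtain h K where h: "smooth_on (x ` U) h" "h (x p) = (1::real)" "compact K" "K \<subseteq> x ` U"
    "\<forall>y. y \<notin> K \<longrightarrow> h y = 0" using chart_bump[OF c] .
  note op = chart_homeomorphism(2)[OF c(1)]
  define V where "V q = (if q \<in> U then h (x q) \<cdot>\<^sub>t coord_vector A (U, x) q u else 0)" for q
  have "V q \<in> tangent_space A q" for q
  proof (cases "q \<in> U")
    case True
    then have "V q = h (x q) \<cdot>\<^sub>t coord_vector A (U, x) q u" by (simp add: V_def)
    moreover have "coord_vector A (U, x) q u \<in> tangent_space A q"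
      unfolding tangent_space_eq_range[OF c(1) True] by (rule rangeI)
    ultimately show ?thesis using tangent_space_scale by simp
  next
    case False
    \<comment> \<open>Off \<open>U\<close> the value is the zero operator, recognised as a tangent
      vector by scaling some tangent vector at \<open>q\<close> by 0.\<close>
    obtain W y where W: "(W, y) \<in> A" "q \<in> W" using ex_chart_at by blast
    have "coord_vector A (W, y) q 0 \<in> tangent_space A q"
      unfolding tangent_space_eq_range[OF W] by simp
    moreover have "0 \<cdot>\<^sub>t t = 0" for t :: "'a tangent"
      by (simp add: scale_tangent_def fun_eq_iff)
    ultimately show ?thesis
      using tangent_space_scale[of _ q 0] False by (fastforce simp: V_def)
  qed
  moreover have "lie_deriv V f \<in> smooth_functions A" if f: "f \<in> smooth_functions A" for f
  proof -
    let ?d = "\<lambda>y. h y * frechet_derivative (f \<circ> chart_inv U x) (at y) u"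
    have "lie_deriv V f = (\<lambda>q. if q \<in> U then ?d (x q) else 0)"
      using f by (auto simp: lie_deriv_def V_def scale_tangent_def coord_vector_apply)
    moreover have "smooth_on (x ` U) ?d"
      using f c(1) by (intro smooth_on_mult smooth_on_frechet_derivative op h(1))
        (simp add: smooth_functions_iff)
    ultimately show ?thesis
      using zero_extension_smooth[OF c(1) _ h(3,4), of ?d] h(5) by simp
  qed
  moreover have "V p = v" using c(2) by (simp add: V_def h(2) u scale_tangent_def)
  ultimately show ?thesis unfolding vector_fields_def by blast
qed

section \<open>The module of vector fields\<close>

lemma extension:
  assumes "v \<in> tangent_space A p"
  shows "extension A p v \<in> vector_fields A" "extension A p v p = v"
  using someI_ex[of "\<lambda>V. V \<in> vector_fields A \<and> V p = v"] ex_vector_field_through[OF assms]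
  unfolding extension_def by blast+

lemma vector_field_tangent: "X \<in> vector_fields A \<Longrightarrow> X p \<in> tangent_space A p"
  unfolding vector_fields_def by blast

lemma lie_deriv_smooth:
  "X \<in> vector_fields A \<Longrightarrow> f \<in> smooth_functions A \<Longrightarrow> lie_deriv X f \<in> smooth_functions A"
  unfolding vector_fields_def by blast

lemma add_vector_field:
  assumes "X \<in> vector_fields A" "Y \<in> vector_fields A"
  shows "X + Y \<in> vector_fields A"
proof -
  have "lie_deriv (X + Y) f = lie_deriv X f + lie_deriv Y f" for f
    by (simp add: lie_deriv_def fun_eq_iff)
  then show ?thesis
    using assms unfolding vector_fields_def by (auto intro: add_smooth tangent_space_add)
qed

lemma scale_vector_field:
  assumes "h \<in> smooth_functions A" "X \<in> vector_fields A"
  shows "h \<cdot>\<^sub>f X \<in> vector_fields A"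
proof -
  have "lie_deriv (h \<cdot>\<^sub>f X) f = h * lie_deriv X f" for f
    by (simp add: lie_deriv_def fun_eq_iff scale_field_def scale_tangent_def)
  then show ?thesis
    using assms unfolding vector_fields_def
    by (auto simp: scale_field_def intro: mult_smooth tangent_space_scale)
qed

lemma diff_vector_field:
  assumes "X \<in> vector_fields A" "Y \<in> vector_fields A"
  shows "X - Y \<in> vector_fields A"
proof -
  have "X - Y = X + (\<lambda>p. -1) \<cdot>\<^sub>f Y"
    by (simp add: fun_eq_iff scale_field_def scale_tangent_def)
  then show ?thesis
    by (simp only: add_vector_field scale_vector_field const_smooth assms)
qed

section \<open>Coordinates and traces on a tangent space\<close>

lemma coords_add:
  assumes c: "(U, x) \<in> A" "p \<in> U" and v: "v \<in> tangent_space A p" "w \<in> tangent_space A p"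
  shows "coords A (U, x) p (v + w) = coords A (U, x) p v + coords A (U, x) p w"
proof -
  obtain s t where "v = coord_vector A (U, x) p s" "w = coord_vector A (U, x) p t"
    using v unfolding tangent_space_eq_range[OF c] by blast
  then show ?thesis
    by (simp add: coord_vector_linear(1)[OF c, symmetric] coords_coord_vector[OF c])
qed

lemma coords_scale:
  assumes c: "(U, x) \<in> A" "p \<in> U" and v: "v \<in> tangent_space A p"
  shows "coords A (U, x) p (a \<cdot>\<^sub>t v) = a *\<^sub>R coords A (U, x) p v"
proof -
  obtain s where "v = coord_vector A (U, x) p s"
    using v unfolding tangent_space_eq_range[OF c] by blast
  then show ?thesis
    by (simp add: coord_vector_linear(2)[OF c, symmetric] coords_coord_vector[OF c])
qed

text \<open>The chart chosen in \<open>trace_at\<close> depends on \<open>p\<close> alone. Stating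
  the equation between functions of \<open>F\<close> provides one chart for all endomorphisms at
  \<open>p\<close>, so that traces can be added and compared.\<close>

lemma trace_at_eq:
  obtains U x where "(U, x) \<in> A" "p \<in> U"
    "trace_at A p = (\<lambda>F. \<Sum>i\<in>Basis. coords A (U, x) p (F (coord_vector A (U, x) p i)) \<bullet> i)"
proof -
  have "\<exists>c. c \<in> charts_at A p" using ex_chart_at by (auto simp: charts_at_def)
  then have "(SOME c. c \<in> charts_at A p) \<in> charts_at A p" by (rule someI_ex)
  moreover obtain U x where Ux: "(SOME c. c \<in> charts_at A p) = (U, x)" by fastforce
  ultimately show thesis using that[of U x] by (simp add: charts_at_iff trace_at_def Let_def fun_eq_iff)
qed

lemma trace_at_cong:
  assumes "\<And>v. v \<in> tangent_space A p \<Longrightarrow> F v = G v"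
  shows "trace_at A p F = trace_at A p G"
proof -
  obtain U x where c: "(U, x) \<in> A" "p \<in> U"
    "trace_at A p = (\<lambda>F. \<Sum>i\<in>Basis. coords A (U, x) p (F (coord_vector A (U, x) p i)) \<bullet> i)"
    using trace_at_eq .
  show ?thesis unfolding c(3) using assms tangent_space_eq_range[OF c(1,2)] by simp
qed

lemma trace_at_add:
  assumes "\<And>v. v \<in> tangent_space A p \<Longrightarrow> F v \<in> tangent_space A p"
    "\<And>v. v \<in> tangent_space A p \<Longrightarrow> G v \<in> tangent_space A p"
  shows "trace_at A p (\<lambda>v. F v + G v) = trace_at A p F + trace_at A p G"
proof -
  obtain U x where c: "(U, x) \<in> A" "p \<in> U"
    "trace_at A p = (\<lambda>F. \<Sum>i\<in>Basis. coords A (U, x) p (F (coord_vector A (U, x) p i)) \<bullet> i)"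
    using trace_at_eq .
  have "coord_vector A (U, x) p i \<in> tangent_space A p" for i
    unfolding tangent_space_eq_range[OF c(1,2)] by simp
  then show ?thesis
    unfolding c(3) using assms
    by (simp add: coords_add[OF c(1,2)] inner_add_left sum.distrib)
qed

lemma trace_at_scale:
  assumes "\<And>v. v \<in> tangent_space A p \<Longrightarrow> F v \<in> tangent_space A p"
  shows "trace_at A p (\<lambda>v. a \<cdot>\<^sub>t F v) = a * trace_at A p F"
proof -
  obtain U x where c: "(U, x) \<in> A" "p \<in> U"
    "trace_at A p = (\<lambda>F. \<Sum>i\<in>Basis. coords A (U, x) p (F (coord_vector A (U, x) p i)) \<bullet> i)"
    using trace_at_eq .
  have "coord_vector A (U, x) p i \<in> tangent_space A p" for i
    unfolding tangent_space_eq_range[OF c(1,2)] by simp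
  then show ?thesis
    unfolding c(3) using assms
    by (simp add: coords_scale[OF c(1,2)] sum_distrib_left)
qed

lemma trace_at_id: "trace_at A p (\<lambda>v. v) = DIM('e)"
proof -
  obtain U x where c: "(U, x) \<in> A" "p \<in> U"
    "trace_at A p = (\<lambda>F. \<Sum>i\<in>Basis. coords A (U, x) p (F (coord_vector A (U, x) p i)) \<bullet> i)"
    using trace_at_eq .
  show ?thesis unfolding c(3) by (simp add: coords_coord_vector[OF c(1,2)])
qed

text \<open>If s is the coordinate vector of \<open>w\<close>, the diagonal entries are
  \<omega>(e_i) s_i, and they add up to \<omega>(w) by linearity.\<close>

lemma trace_at_rank_one:
  assumes w: "w \<in> tangent_space A p"
    and add: "\<And>u v. u \<in> tangent_space A p \<Longrightarrow> v \<in> tangent_space A p \<Longrightarrow> \<omega> (u + v) = \<omega> u + \<omega> v"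
    and scale: "\<And>a u. u \<in> tangent_space A p \<Longrightarrow> \<omega> (a \<cdot>\<^sub>t u) = a * \<omega> u"
  shows "trace_at A p (\<lambda>v. \<omega> v \<cdot>\<^sub>t w) = \<omega> w"
proof -
  obtain U x where c: "(U, x) \<in> A" "p \<in> U"
    "trace_at A p = (\<lambda>F. \<Sum>i\<in>Basis. coords A (U, x) p (F (coord_vector A (U, x) p i)) \<bullet> i)"
    using trace_at_eq .
  have ts: "coord_vector A (U, x) p i \<in> tangent_space A p" for i
    unfolding tangent_space_eq_range[OF c(1,2)] by simp
  obtain s where s: "w = coord_vector A (U, x) p s"
    using w unfolding tangent_space_eq_range[OF c(1,2)] by blast
  have "linear (\<lambda>u. \<omega> (coord_vector A (U, x) p u))"
    by (rule linearI) (simp_all add: coord_vector_linear[OF c(1,2)] add scale ts)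
  from linear_basis_expansion[OF this, of s] show ?thesis
    unfolding c(3) using w
    by (simp add: coords_scale[OF c(1,2)] s coords_coord_vector[OF c(1,2)] mult.commute)
qed

end

section \<open>Kenmotsu geometry\<close>

locale kenmotsu = manifold A
  for A :: "('a::{t2_space,second_countable_topology}, 'e::euclidean_space) chart set" +
  fixes \<phi> :: "'a endo_field" and \<xi> :: "'a vector_field" and \<eta> :: "'a covector_field"
    and g :: "'a bilinear_field" and D :: "'a connection" and \<beta> :: real and n :: nat
  assumes beta_kenmotsu: "beta_kenmotsu n A \<phi> \<xi> \<eta> g D \<beta>"
begin

section \<open>The structure equations, pointwise and for fields\<close>

lemma almost_contact_metric: "almost_contact_metric n A \<phi> \<xi> \<eta> g"
  and levi_civita: "levi_civita A g D"
  and beta_pos: "\<beta> > 0"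
  using beta_kenmotsu unfolding beta_kenmotsu_def by simp_all

lemma n_pos: "n \<ge> 1"
  and dim: "DIM('e) = 2 * n + 1"
  and xi_field: "\<xi> \<in> vector_fields A"
  and tensor_phi: "tensor_field_1_1 A \<phi>"
  and form_eta: "one_form A \<eta>"
  and metric_g: "riemannian_metric A g"
  and eta_xi_ap: "ap \<eta> \<xi> = 1"
  and phi_xi: "ap \<phi> \<xi> = 0"
  using almost_contact_metric unfolding almost_contact_metric_def by simp_all

lemma eta_phi: "X \<in> vector_fields A \<Longrightarrow> ap \<eta> (ap \<phi> X) = 0"
  and phi_phi: "X \<in> vector_fields A \<Longrightarrow> ap \<phi> (ap \<phi> X) = - X + ap \<eta> X \<cdot>\<^sub>f \<xi>"
  and eta_eq_ap: "X \<in> vector_fields A \<Longrightarrow> ap \<eta> X = ap2 g X \<xi>"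
  using almost_contact_metric unfolding almost_contact_metric_def by simp_all

lemma eta_xi: "\<eta> p (\<xi> p) = 1"
  using fun_cong[OF eta_xi_ap, of p] by (simp add: ap_def)

lemma eta_eq: "X \<in> vector_fields A \<Longrightarrow> \<eta> p (X p) = g p (X p) (\<xi> p)"
  using fun_cong[OF eta_eq_ap, of X p] by (simp add: ap_def ap2_def)

lemma eta_add: "v \<in> tangent_space A p \<Longrightarrow> w \<in> tangent_space A p \<Longrightarrow> \<eta> p (v + w) = \<eta> p v + \<eta> p w"
  and eta_scale: "v \<in> tangent_space A p \<Longrightarrow> \<eta> p (a \<cdot>\<^sub>t v) = a * \<eta> p v"
  and eta_smooth: "X \<in> vector_fields A \<Longrightarrow> ap \<eta> X \<in> smooth_functions A"
  using form_eta unfolding one_form_def by blast+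

lemma phi_scale: "v \<in> tangent_space A p \<Longrightarrow> \<phi> p (a \<cdot>\<^sub>t v) = a \<cdot>\<^sub>t \<phi> p v"
  and phi_field: "X \<in> vector_fields A \<Longrightarrow> ap \<phi> X \<in> vector_fields A"
  using tensor_phi unfolding tensor_field_1_1_def by blast+

lemma g_add: "u \<in> tangent_space A p \<Longrightarrow> v \<in> tangent_space A p \<Longrightarrow> w \<in> tangent_space A p \<Longrightarrow>
    g p (u + v) w = g p u w + g p v w"
  and g_scale: "u \<in> tangent_space A p \<Longrightarrow> w \<in> tangent_space A p \<Longrightarrow> g p (a \<cdot>\<^sub>t u) w = a * g p u w"
  and g_sym: "u \<in> tangent_space A p \<Longrightarrow> v \<in> tangent_space A p \<Longrightarrow> g p u v = g p v u"
  using metric_g unfolding riemannian_metric_def by blast+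

lemma affine: "affine_connection A D"
  using levi_civita unfolding levi_civita_def by simp

text \<open>The clauses of \<open>affine_connection\<close> stand under one joint quantifier that
  includes a smooth function; a constant function instantiates it where no function occurs in the
  clause.\<close>

lemma D_field: "X \<in> vector_fields A \<Longrightarrow> Y \<in> vector_fields A \<Longrightarrow> D X Y \<in> vector_fields A"
  using affine const_smooth unfolding affine_connection_def by blast

lemma D_add: "X \<in> vector_fields A \<Longrightarrow> Y \<in> vector_fields A \<Longrightarrow> Z \<in> vector_fields A \<Longrightarrow>
    D X (Y + Z) = D X Y + D X Z"
  using affine const_smooth unfolding affine_connection_def by blast

lemma D_scale: "X \<in> vector_fields A \<Longrightarrow> Y \<in> vector_fields A \<Longrightarrow> h \<in> smooth_functions A \<Longrightarrow>
    D X (h \<cdot>\<^sub>f Y) = h \<cdot>\<^sub>f D X Y + lie_deriv X h \<cdot>\<^sub>f Y"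
  using affine unfolding affine_connection_def by blast

lemma torsion_free: "X \<in> vector_fields A \<Longrightarrow> Y \<in> vector_fields A \<Longrightarrow>
    lie_bracket X Y = D X Y - D Y X"
  using levi_civita unfolding levi_civita_def by simp

lemma metric_compatible:
  assumes "X \<in> vector_fields A" "Y \<in> vector_fields A" "Z \<in> vector_fields A"
  shows "lie_deriv X (ap2 g Y Z) p = g p (D X Y p) (Z p) + g p (Y p) (D X Z p)"
proof -
  have "lie_deriv X (ap2 g Y Z) = ap2 g (D X Y) Z + ap2 g Y (D X Z)"
    using levi_civita assms unfolding levi_civita_def by simp
  then show ?thesis by (simp add: ap2_def)
qed

text \<open>Torsion-freeness spares the coordinate computation that brackets are vector fields.\<close>

lemma bracket_field: "X \<in> vector_fields A \<Longrightarrow> Y \<in> vector_fields A \<Longrightarrow> lie_bracket X Y \<in> vector_fields A"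
  by (simp add: torsion_free diff_vector_field D_field)

section \<open>Covariant derivatives of \<xi> and \<eta>\<close>

lemma lie_deriv_const: "X \<in> vector_fields A \<Longrightarrow> lie_deriv X (\<lambda>p. a) = (\<lambda>p. 0)"
  by (simp add: lie_deriv_def tangent_const[OF vector_field_tangent])

lemma lie_deriv_const_mult:
  "X \<in> vector_fields A \<Longrightarrow> f \<in> smooth_functions A \<Longrightarrow>
    lie_deriv X (\<lambda>q. a * f q) p = a * lie_deriv X f p"
  unfolding lie_deriv_def by (rule tangent_const_mult[OF vector_field_tangent])

lemma D_scale_const:
  assumes "X \<in> vector_fields A" "Y \<in> vector_fields A"
  shows "D X ((\<lambda>p. a) \<cdot>\<^sub>f Y) = (\<lambda>p. a) \<cdot>\<^sub>f D X Y"
  using D_scale[OF assms const_smooth, of a] lie_deriv_const[OF assms(1), of a]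
  by (simp add: fun_eq_iff scale_field_def scale_tangent_def)

lemma D_zero:
  assumes "X \<in> vector_fields A"
  shows "D X 0 = 0"
  using D_scale_const[OF assms assms, of 0]
  by (simp add: scale_field_def scale_tangent_def zero_fun_def)

text \<open>The field \<xi> has constant length 1, so metric compatibility makes its derivatives
  orthogonal to it.\<close>

lemma eta_D_xi:
  assumes X: "X \<in> vector_fields A"
  shows "\<eta> p (D X \<xi> p) = 0"
proof -
  note DX = D_field[OF X xi_field]
  have "ap2 g \<xi> \<xi> = (\<lambda>p. 1)"
    using eta_eq_ap[OF xi_field] eta_xi_ap by (simp add: one_fun_def)
  then have "0 = g p (D X \<xi> p) (\<xi> p) + g p (\<xi> p) (D X \<xi> p)"
    using metric_compatible[OF X xi_field xi_field, of p] lie_deriv_const[OF X, of 1] by simp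
  then show ?thesis
    using eta_eq[OF DX, of p] g_sym[OF vector_field_tangent[OF xi_field] vector_field_tangent[OF DX]]
    by simp
qed

text \<open>Putting Y = \<xi> into the Kenmotsu condition leaves \<open>ap \<phi> (D X \<xi>) =
  (\<lambda>p. \<beta>) \<cdot>\<^sub>f ap \<phi> X\<close>, since \<phi>(\<xi>) = 0 and g(\<phi>X,
  \<xi>) = \<eta>(\<phi>X) = 0. Applying \<phi> once more determines \<open>D X \<xi>\<close> up to
  its \<xi>-component, which vanishes by \<open>eta_D_xi\<close>.\<close>

lemma D_xi:
  assumes X: "X \<in> vector_fields A"
  shows "D X \<xi> = (\<lambda>p. \<beta>) \<cdot>\<^sub>f X + (\<lambda>p. - \<beta> * ap \<eta> X p) \<cdot>\<^sub>f \<xi>"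
proof -
  note DX = D_field[OF X xi_field]
  have "nabla_endo D \<phi> X \<xi>
      = (\<lambda>_. \<beta>) \<cdot>\<^sub>f (ap2 g (ap \<phi> X) \<xi> \<cdot>\<^sub>f \<xi> - ap \<eta> \<xi> \<cdot>\<^sub>f ap \<phi> X)"
    using beta_kenmotsu X xi_field unfolding beta_kenmotsu_def by blast
  moreover have "ap2 g (ap \<phi> X) \<xi> = 0"
    using eta_eq_ap[OF phi_field[OF X]] eta_phi[OF X] by simp
  ultimately have "ap \<phi> (D X \<xi>) = (\<lambda>p. \<beta>) \<cdot>\<^sub>f ap \<phi> X"
    by (simp add: nabla_endo_def phi_xi eta_xi_ap D_zero[OF X] fun_eq_iff scale_field_def
        scale_tangent_def)
  then have "ap \<phi> (ap \<phi> (D X \<xi>)) = ap \<phi> ((\<lambda>p. \<beta>) \<cdot>\<^sub>f ap \<phi> X)" by simp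
  also have "\<dots> = (\<lambda>p. \<beta>) \<cdot>\<^sub>f ap \<phi> (ap \<phi> X)"
    using phi_scale[OF vector_field_tangent[OF phi_field[OF X]]]
    by (intro ext) (simp add: scale_field_def ap_def)
  finally have "- D X \<xi> p f + ap \<eta> (D X \<xi>) p * \<xi> p f = \<beta> * (- X p f + ap \<eta> X p * \<xi> p f)" for p f
    unfolding phi_phi[OF DX] phi_phi[OF X]
    by (simp add: fun_eq_iff scale_field_def scale_tangent_def)
  moreover have "ap \<eta> (D X \<xi>) p = 0" for p
    using eta_D_xi[OF X] by (simp add: ap_def)
  ultimately have "D X \<xi> p f = \<beta> * X p f - \<beta> * ap \<eta> X p * \<xi> p f" for p f
    by (simp add: algebra_simps)
  then show ?thesis
    by (simp add: fun_eq_iff scale_field_def scale_tangent_def)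
qed

text \<open>Differentiate \<eta>(Y) = g(Y, \<xi>) and insert \<open>D_xi\<close>. The second summand
  is the covariant derivative of \<eta>; it is symmetric in \<open>X\<close> and \<open>Y\<close>,
  so \<eta> is closed.\<close>

lemma lie_deriv_eta:
  assumes X: "X \<in> vector_fields A" and Y: "Y \<in> vector_fields A"
  shows "lie_deriv X (ap \<eta> Y) p
    = \<eta> p (D X Y p) + \<beta> * (g p (X p) (Y p) - \<eta> p (X p) * \<eta> p (Y p))"
proof -
  note t = vector_field_tangent[OF X] vector_field_tangent[OF Y] vector_field_tangent[OF xi_field]
  have Dp: "D X \<xi> p = \<beta> \<cdot>\<^sub>t X p + (- \<beta> * \<eta> p (X p)) \<cdot>\<^sub>t \<xi> p"
    by (simp add: D_xi[OF X] scale_field_def ap_def)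
  have "g p (Y p) (D X \<xi> p) = g p (D X \<xi> p) (Y p)"
    by (rule g_sym[OF t(2) vector_field_tangent[OF D_field[OF X xi_field]]])
  also have "\<dots> = \<beta> * g p (X p) (Y p) - \<beta> * \<eta> p (X p) * g p (\<xi> p) (Y p)"
    unfolding Dp by (simp add: g_add g_scale tangent_space_scale t)
  also have "g p (\<xi> p) (Y p) = \<eta> p (Y p)"
    using g_sym[OF t(3) t(2)] eta_eq[OF Y] by simp
  finally show ?thesis
    unfolding eta_eq_ap[OF Y] metric_compatible[OF X Y xi_field]
    by (simp add: eta_eq[OF D_field[OF X Y]] algebra_simps)
qed

section \<open>Curvature and Ricci tensor applied to \<xi>\<close>

lemma scaled_eta_smooth:
  assumes "X \<in> vector_fields A"
  shows "(\<lambda>p. a * ap \<eta> X p) \<in> smooth_functions A"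
  using mult_smooth[OF const_smooth eta_smooth[OF assms]] by (simp add: times_fun_def)

text \<open>Leibniz rule applied to the formula for \<open>D Y \<xi>\<close>. The derivative of
  \<eta>(Y) and \<open>D X \<xi>\<close> stay unexpanded until the difference in \<open>X\<close>
  and \<open>Y\<close> is formed.\<close>

lemma D_D_xi:
  assumes X: "X \<in> vector_fields A" and Y: "Y \<in> vector_fields A"
  shows "D X (D Y \<xi>) p f = \<beta> * D X Y p f - \<beta> * lie_deriv X (ap \<eta> Y) p * \<xi> p f
    - \<beta> * \<eta> p (Y p) * D X \<xi> p f"
proof -
  note s = scaled_eta_smooth[OF Y]
  have "D X (D Y \<xi>) = (\<lambda>p. \<beta>) \<cdot>\<^sub>f D X Y + ((\<lambda>p. - \<beta> * ap \<eta> Y p) \<cdot>\<^sub>f D X \<xi>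
      + lie_deriv X (\<lambda>p. - \<beta> * ap \<eta> Y p) \<cdot>\<^sub>f \<xi>)"
    unfolding D_xi[OF Y]
    by (simp only: D_add[OF X scale_vector_field[OF const_smooth Y] scale_vector_field[OF s xi_field]]
        D_scale_const[OF X Y] D_scale[OF X xi_field s])
  then show ?thesis
    using lie_deriv_const_mult[OF X eta_smooth[OF Y], of "- \<beta>" p]
    by (simp add: scale_field_def scale_tangent_def ap_def)
qed

lemma curvature_xi:
  assumes X: "X \<in> vector_fields A" and Y: "Y \<in> vector_fields A"
  shows "curvature D X Y \<xi> p = \<beta>\<^sup>2 \<cdot>\<^sub>t (\<eta> p (X p) \<cdot>\<^sub>t Y p + (- \<eta> p (Y p)) \<cdot>\<^sub>t X p)"
proof
  fix f
  let ?B = "lie_bracket X Y"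
  have D_xi_apply: "D Z \<xi> p f = \<beta> * Z p f - \<beta> * \<eta> p (Z p) * \<xi> p f" if "Z \<in> vector_fields A" for Z
    by (simp add: D_xi[OF that] scale_field_def scale_tangent_def ap_def)
  \<comment> \<open>Writing the difference of \<open>D X Y\<close> and \<open>D Y X\<close> as the
    bracket makes the bracket terms cancel against \<open>D ?B \<xi>\<close>, and symmetry of g
    removes the derivative of \<eta>. Only \<beta> \<eta>(X) \<open>D Y \<xi>\<close> - \<beta>
    \<eta>(Y) \<open>D X \<xi>\<close> remains, in which the \<xi>-components cancel.\<close>
  have "D X Y p = ?B p + D Y X p" by (simp add: torsion_free[OF X Y])
  then have "\<eta> p (D X Y p) = \<eta> p (?B p) + \<eta> p (D Y X p)" and "D X Y p f = ?B p f + D Y X p f"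
    by (simp_all add: eta_add vector_field_tangent bracket_field D_field X Y)
  moreover have "g p (Y p) (X p) = g p (X p) (Y p)"
    by (rule g_sym) (simp_all add: vector_field_tangent X Y)
  ultimately show "curvature D X Y \<xi> p f = (\<beta>\<^sup>2 \<cdot>\<^sub>t (\<eta> p (X p) \<cdot>\<^sub>t Y p + (- \<eta> p (Y p)) \<cdot>\<^sub>t X p)) f"
    by (simp add: curvature_def D_D_xi X Y D_xi_apply bracket_field lie_deriv_eta scale_tangent_def
        power2_eq_square algebra_simps)
qed

text \<open>The endomorphism under the trace is \<beta>^2 times a rank-one map of trace \<eta>(X)
  minus \<eta>(X) times the identity, whose trace is the dimension 2n + 1. Altogether this is
  \<beta>^2 (1 - (2n + 1)) \<eta>(X).\<close>

lemma ricci_xi: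
  assumes X: "X \<in> vector_fields A"
  shows "ricci A D X \<xi> p = - (2 * n * \<beta>\<^sup>2) * \<eta> p (X p)"
proof -
  note Xp = vector_field_tangent[OF X, of p]
  have "ricci A D X \<xi> p
      = trace_at A p (\<lambda>v. \<beta>\<^sup>2 \<cdot>\<^sub>t (\<eta> p v \<cdot>\<^sub>t X p + (- \<eta> p (X p)) \<cdot>\<^sub>t v))"
    unfolding ricci_def
    by (rule trace_at_cong) (simp add: curvature_xi[OF _ X] extension)
  also have "\<dots> = \<beta>\<^sup>2 * (trace_at A p (\<lambda>v. \<eta> p v \<cdot>\<^sub>t X p) + - \<eta> p (X p) * trace_at A p (\<lambda>v. v))"
    by (simp add: trace_at_add trace_at_scale tangent_space_add tangent_space_scale Xp)
  also have "trace_at A p (\<lambda>v. \<eta> p v \<cdot>\<^sub>t X p) = \<eta> p (X p)"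
    by (rule trace_at_rank_one[OF Xp]) (simp_all add: eta_add eta_scale)
  finally show ?thesis by (simp add: trace_at_id dim algebra_simps)
qed

section \<open>Linearity of curvature and Ricci tensor over smooth functions in the last
  argument\<close>

lemma curvature_field:
  "X \<in> vector_fields A \<Longrightarrow> Y \<in> vector_fields A \<Longrightarrow> Z \<in> vector_fields A \<Longrightarrow>
    curvature D X Y Z \<in> vector_fields A"
  by (simp add: curvature_def diff_vector_field D_field bracket_field)

lemma curvature_add:
  assumes "X \<in> vector_fields A" "Y \<in> vector_fields A" "Z \<in> vector_fields A" "W \<in> vector_fields A"
  shows "curvature D X Y (Z + W) = curvature D X Y Z + curvature D X Y W"
  unfolding curvature_def by (simp add: D_add D_field bracket_field assms)

text \<open>The two terms with one derivative on \<open>h\<close> and one on \<open>Z\<close> are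
  together symmetric in \<open>X\<close> and \<open>Y\<close>, hence disappear from the
  curvature.\<close>

lemma D_D_scale:
  assumes X: "X \<in> vector_fields A" and Y: "Y \<in> vector_fields A" and Z: "Z \<in> vector_fields A"
    and h: "h \<in> smooth_functions A"
  shows "D X (D Y (h \<cdot>\<^sub>f Z)) = (h \<cdot>\<^sub>f D X (D Y Z) + lie_deriv X h \<cdot>\<^sub>f D Y Z)
    + (lie_deriv Y h \<cdot>\<^sub>f D X Z + lie_deriv X (lie_deriv Y h) \<cdot>\<^sub>f Z)"
  by (simp only: D_scale[OF Y Z h] D_scale[OF X D_field[OF Y Z] h]
      D_scale[OF X Z lie_deriv_smooth[OF Y h]]
      D_add[OF X scale_vector_field[OF h D_field[OF Y Z]]
        scale_vector_field[OF lie_deriv_smooth[OF Y h] Z]])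

text \<open>After the mixed terms cancel, the second derivatives of \<open>h\<close> form XYh - YXh,
  which is exactly what the bracket term subtracts.\<close>

lemma curvature_scale:
  assumes X: "X \<in> vector_fields A" and Y: "Y \<in> vector_fields A" and Z: "Z \<in> vector_fields A"
    and h: "h \<in> smooth_functions A"
  shows "curvature D X Y (h \<cdot>\<^sub>f Z) = h \<cdot>\<^sub>f curvature D X Y Z"
proof -
  have bracket: "lie_deriv (lie_bracket X Y) h p
      = lie_deriv X (lie_deriv Y h) p - lie_deriv Y (lie_deriv X h) p" for p
    by (simp add: lie_deriv_def lie_bracket_def)
  show ?thesis
    unfolding curvature_def D_D_scale[OF X Y Z h] D_D_scale[OF Y X Z h]
      D_scale[OF bracket_field[OF X Y] Z h]
    by (simp add: fun_eq_iff scale_field_def scale_tangent_def bracket algebra_simps)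
qed

lemma ricci_add:
  assumes Y: "Y \<in> vector_fields A" and Z: "Z \<in> vector_fields A" and W: "W \<in> vector_fields A"
  shows "ricci A D Y (Z + W) p = ricci A D Y Z p + ricci A D Y W p"
proof -
  have "ricci A D Y (Z + W) p = trace_at A p
      (\<lambda>v. curvature D (extension A p v) Y Z p + curvature D (extension A p v) Y W p)"
    unfolding ricci_def by (rule trace_at_cong) (simp add: curvature_add[OF _ Y Z W] extension)
  then show ?thesis
    unfolding ricci_def
    by (simp add: trace_at_add vector_field_tangent curvature_field extension Y Z W)
qed

text \<open>Together with \<open>ricci_add\<close> this allows \<open>D X \<xi>\<close>, a
  combination of \<open>X\<close> and \<xi> with function coefficients, to be expanded inside the
  Ricci tensor.\<close>

lemma ricci_scale:
  assumes Y: "Y \<in> vector_fields A" and Z: "Z \<in> vector_fields A" and h: "h \<in> smooth_functions A"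
  shows "ricci A D Y (h \<cdot>\<^sub>f Z) p = h p * ricci A D Y Z p"
proof -
  have "ricci A D Y (h \<cdot>\<^sub>f Z) p = trace_at A p (\<lambda>v. h p \<cdot>\<^sub>t curvature D (extension A p v) Y Z p)"
    unfolding ricci_def
    by (rule trace_at_cong) (simp add: curvature_scale[OF _ Y Z h] extension, simp add: scale_field_def)
  then show ?thesis
    unfolding ricci_def
    by (simp add: trace_at_scale vector_field_tangent curvature_field extension Y Z)
qed

section \<open>Special weak Ricci symmetry and the Einstein condition\<close>

lemma nabla_ricci_xi:
  assumes X: "X \<in> vector_fields A" and Y: "Y \<in> vector_fields A"
  shows "nabla_ricci A D X Y \<xi> p
    = - (2 * n * \<beta>\<^sup>2) * \<beta> * g p (X p) (Y p) - \<beta> * ricci A D Y X p"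
proof -
  have "ricci A D Y \<xi> = (\<lambda>p. - (2 * n * \<beta>\<^sup>2) * ap \<eta> Y p)"
    by (rule ext) (simp add: ricci_xi[OF Y] ap_def)
  then have 1: "lie_deriv X (ricci A D Y \<xi>) p = - (2 * n * \<beta>\<^sup>2) *
      (\<eta> p (D X Y p) + \<beta> * (g p (X p) (Y p) - \<eta> p (X p) * \<eta> p (Y p)))"
    by (simp only: lie_deriv_const_mult[OF X eta_smooth[OF Y]] lie_deriv_eta[OF X Y])
  have 2: "ricci A D Y (D X \<xi>) p = \<beta> * ricci A D Y X p + (- \<beta> * ap \<eta> X p) * ricci A D Y \<xi> p"
    unfolding D_xi[OF X]
    by (simp only: ricci_add[OF Y scale_vector_field[OF const_smooth X]
          scale_vector_field[OF scaled_eta_smooth[OF X] xi_field]]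
        ricci_scale[OF Y X const_smooth] ricci_scale[OF Y xi_field scaled_eta_smooth[OF X]])
  \<comment> \<open>The term \<eta>(\<open>D X Y\<close>) cancels against the Ricci tensor of
    \<open>D X Y\<close> and \<xi>, and the products \<eta>(X) \<eta>(Y) from \<open>1\<close> and
    \<open>2\<close> cancel each other.\<close>
  show ?thesis
    unfolding nabla_ricci_def
    by (simp add: 1 2 ap_def ricci_xi[OF Y] ricci_xi[OF D_field[OF X Y]] algebra_simps)
qed

lemma special_weakly_ricci_symmetric_imp_einstein:
  assumes "special_weakly_ricci_symmetric A D"
  shows "einstein A g D"
proof -
  let ?K = "2 * n * \<beta>\<^sup>2"
  have K: "?K > 0" using n_pos beta_pos by simp
  obtain \<rho> where \<rho>: "\<And>X Y Z p. X \<in> vector_fields A \<Longrightarrow> Y \<in> vector_fields A \<Longrightarrow> Z \<in> vector_fields A \<Longrightarrow>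
      nabla_ricci A D X Y Z p = 2 * \<rho> p (X p) * ricci A D Y Z p + \<rho> p (Y p) * ricci A D Z X p
        + \<rho> p (Z p) * ricci A D X Y p"
    using assms unfolding special_weakly_ricci_symmetric_def by blast
  \<comment> \<open>The defining identity with third argument \<xi>. The factor
    \<open>ricci A D \<xi> X p\<close> has \<xi> in the first slot, where \<open>ricci_xi\<close>
    does not apply; it is evaluated only for X = \<xi>, and later it is multiplied by \<rho>(Y) =
    0.\<close>
  have eq: "- ?K * \<beta> * g p (X p) (Y p) - \<beta> * ricci A D Y X p
      = - 2 * ?K * \<rho> p (X p) * \<eta> p (Y p) + \<rho> p (Y p) * ricci A D \<xi> X p + \<rho> p (\<xi> p) * ricci A D X Y p"
    if X: "X \<in> vector_fields A" and Y: "Y \<in> vector_fields A" for X Y p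
    using \<rho>[OF X Y xi_field, of p] unfolding nabla_ricci_xi[OF X Y]
    by (simp add: ricci_xi[OF Y] algebra_simps)
  have g_xi: "g p (\<xi> p) (Y p) = \<eta> p (Y p)" if "Y \<in> vector_fields A" for Y p
    using g_sym[OF vector_field_tangent[OF xi_field] vector_field_tangent[OF that]] eta_eq[OF that]
    by simp
  \<comment> \<open>For X = Y = \<xi> the left side is -K\<beta> + \<beta>K = 0 and the right side
    is -4K \<rho>(\<xi>).\<close>
  have "?K * \<rho> p (\<xi> p) = 0" for p
    using eq[OF xi_field xi_field, of p]
    by (simp add: g_xi[OF xi_field] ricci_xi[OF xi_field] eta_xi algebra_simps)
  then have \<rho>_xi: "\<rho> p (\<xi> p) = 0" for p using K by (metis mult_eq_0_iff less_irrefl)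
  \<comment> \<open>For X = \<xi> the left side again vanishes; as \<rho>(\<xi>) = 0, the right side
    is -K \<rho>(Y).\<close>
  have "?K * \<rho> p (Y p) = 0" if "Y \<in> vector_fields A" for Y p
    using eq[OF xi_field that, of p]
    by (simp add: g_xi that ricci_xi[OF xi_field] ricci_xi[OF that] eta_xi \<rho>_xi algebra_simps)
  then have \<rho>_0: "\<rho> p (Y p) = 0" if "Y \<in> vector_fields A" for Y p
    using K that by (metis mult_eq_0_iff less_irrefl)
  have "ricci A D Y Z p = - ?K * g p (Y p) (Z p)"
    if Y: "Y \<in> vector_fields A" and Z: "Z \<in> vector_fields A" for Y Z p
  proof -
    \<comment> \<open>With \<rho> = 0 the right side of \<open>eq\<close> is 0. The fields are
      inserted in the order \<open>Z\<close>, \<open>Y\<close> because \<open>eq\<close> contains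
      the Ricci tensor with its two arguments exchanged; the positive \<beta> is then
      cancelled.\<close>
    have "\<beta> * ricci A D Y Z p = \<beta> * (- ?K * g p (Z p) (Y p))"
      using eq[OF Z Y, of p] by (simp add: \<rho>_0 Y Z xi_field algebra_simps)
    then have "ricci A D Y Z p = - ?K * g p (Z p) (Y p)"
      using beta_pos by (simp only: mult_cancel_left) simp
    then show ?thesis
      using g_sym[OF vector_field_tangent[OF Z] vector_field_tangent[OF Y]] by simp
  qed
  then show ?thesis unfolding einstein_def by blast
qed

end

theorem proposition2:
  fixes A :: "('a::{t2_space,second_countable_topology}, 'e::euclidean_space) chart set"
    and \<phi> :: "'a endo_field" and \<xi> :: "'a vector_field" and \<eta> :: "'a covector_field"
    and g :: "'a bilinear_field" and D :: "'a connection" and \<beta> :: real and n :: nat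
  assumes "beta_kenmotsu n A \<phi> \<xi> \<eta> g D \<beta>"
    and "special_weakly_ricci_symmetric A D"
  shows "einstein A g D"
proof -
  interpret kenmotsu A \<phi> \<xi> \<eta> g D \<beta> n
    using assms(1)
    by unfold_locales (simp_all add: beta_kenmotsu_def almost_contact_metric_def)
  show ?thesis by (rule special_weakly_ricci_symmetric_imp_einstein[OF assms(2)])
qed

end
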